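(* Let $R$ be a commutative ring with identity and suppose that $(A,B)$ is an algebraic Cartan pair over $R$. Then $(A,B)$ is an algebraic quasi-Cartan pair, and every conditional expectation $P\colon A\to B$ is implemented by idempotents.
   Context: Let $A$ be an $R$-algebra and $B\subseteq A$ a commutative subalgebra. $I(B)$ is the set of idempotents of $B$; it is a set of local units for $A$ if every finite $\{a_1,\dots,a_n\}\subseteq A$ admits $e\in I(B)$ with $ea_i=a_i=a_ie$ for all $i$. In that case $N(B)=\{n\in A:\exists k\in A,\ knk=k,\ nkn=n,\ kBn\cup nBk\subseteq B\}$. A conditional expectation $P\colon A\to B$ is an $R$-linear map with $P|_B=\mathrm{id}_B$ and $P(bab')=bP(a)b'$ for $a\in A$, $b,b'\in B$; it is faithful if for each $a\in A\setminus\{0\}$ there is $n\in N(B)$ with $P(na)\neq0$, and implemented by idempotents if for each $n\in N(B)$ there is $e\in I(B)$ with $P(n)=ne=en$. Suppose that: if $t\in R$ and $e\in I(B)\setminus\{0\}$ satisfy $te=0$, then $t=0$; (i) $I(B)$ is a set of local units for $A$; (ii) $B=\operatorname{span}_RI(B)$; (iii) $A=\operatorname{span}_RN(B)$; (iv) there is a faithful conditional expectation $A\to B$. Then $(A,B)$ is an algebraic Cartan pair if $B$ is a maximal commutative subalgebra of $A$, and an algebraic quasi-Cartan pair if there is a faithful conditional expectation $A\to B$ that is implemented by idempotents. *)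

theory Defs
  imports "HOL-Algebra.Module"
begin

text \<open>
  An associative algebra over a commutative ring, not required to be commutative or unital. The
  locale \<open>algebra\<close> of \<open>HOL-Algebra\<close> is not applicable, since it demands a commutative unital
  multiplication. The field \<open>one\<close> of the record \<open>A\<close> is part of the record type only: no assumption
  is made about it and no definition below uses it.
\<close>

locale assoc_algebra = module R A for R (structure) and A (structure) +
  assumes mult_closed: "\<lbrakk>x \<in> carrier A; y \<in> carrier A\<rbrakk> \<Longrightarrow> x \<otimes>\<^bsub>A\<^esub> y \<in> carrier A"
    and mult_assoc: "\<lbrakk>x \<in> carrier A; y \<in> carrier A; z \<in> carrier A\<rbrakk>
      \<Longrightarrow> (x \<otimes>\<^bsub>A\<^esub> y) \<otimes>\<^bsub>A\<^esub> z = x \<otimes>\<^bsub>A\<^esub> (y \<otimes>\<^bsub>A\<^esub> z)"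
    and mult_l_distr: "\<lbrakk>x \<in> carrier A; y \<in> carrier A; z \<in> carrier A\<rbrakk>
      \<Longrightarrow> (x \<oplus>\<^bsub>A\<^esub> y) \<otimes>\<^bsub>A\<^esub> z = x \<otimes>\<^bsub>A\<^esub> z \<oplus>\<^bsub>A\<^esub> y \<otimes>\<^bsub>A\<^esub> z"
    and mult_r_distr: "\<lbrakk>x \<in> carrier A; y \<in> carrier A; z \<in> carrier A\<rbrakk>
      \<Longrightarrow> z \<otimes>\<^bsub>A\<^esub> (x \<oplus>\<^bsub>A\<^esub> y) = z \<otimes>\<^bsub>A\<^esub> x \<oplus>\<^bsub>A\<^esub> z \<otimes>\<^bsub>A\<^esub> y"
    and smult_mult_l: "\<lbrakk>t \<in> carrier R; x \<in> carrier A; y \<in> carrier A\<rbrakk>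
      \<Longrightarrow> (t \<odot>\<^bsub>A\<^esub> x) \<otimes>\<^bsub>A\<^esub> y = t \<odot>\<^bsub>A\<^esub> (x \<otimes>\<^bsub>A\<^esub> y)"
    and smult_mult_r: "\<lbrakk>t \<in> carrier R; x \<in> carrier A; y \<in> carrier A\<rbrakk>
      \<Longrightarrow> x \<otimes>\<^bsub>A\<^esub> (t \<odot>\<^bsub>A\<^esub> y) = t \<odot>\<^bsub>A\<^esub> (x \<otimes>\<^bsub>A\<^esub> y)"

locale comm_subalgebra = submodule B R A for B and R (structure) and A (structure) +
  assumes sub_mult_closed: "\<lbrakk>x \<in> B; y \<in> B\<rbrakk> \<Longrightarrow> x \<otimes>\<^bsub>A\<^esub> y \<in> B"
    and sub_mult_comm: "\<lbrakk>x \<in> B; y \<in> B\<rbrakk> \<Longrightarrow> x \<otimes>\<^bsub>A\<^esub> y = y \<otimes>\<^bsub>A\<^esub> x"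

definition maximal_comm_subalgebra ::
    "'a set \<Rightarrow> ('r, 'm) ring_scheme \<Rightarrow> ('r, 'a, 'n) module_scheme \<Rightarrow> bool" where
  "maximal_comm_subalgebra B R A \<longleftrightarrow>
     comm_subalgebra B R A \<and> (\<forall>C. comm_subalgebra C R A \<and> B \<subseteq> C \<longrightarrow> C = B)"

definition lin_span ::
    "('r, 'm) ring_scheme \<Rightarrow> ('r, 'a, 'n) module_scheme \<Rightarrow> 'a set \<Rightarrow> 'a set" where
  "lin_span R A S =
     {(\<Oplus>\<^bsub>A\<^esub>s\<in>F. c s \<odot>\<^bsub>A\<^esub> s) | F c. finite F \<and> F \<subseteq> S \<and> c \<in> F \<rightarrow> carrier R}"

definition idempotents :: "('r, 'a, 'n) module_scheme \<Rightarrow> 'a set \<Rightarrow> 'a set" where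
  "idempotents A B = {e \<in> B. e \<otimes>\<^bsub>A\<^esub> e = e}"

definition local_units :: "('r, 'a, 'n) module_scheme \<Rightarrow> 'a set \<Rightarrow> bool" where
  "local_units A E \<longleftrightarrow>
     (\<forall>F. finite F \<and> F \<subseteq> carrier A \<longrightarrow> (\<exists>e\<in>E. \<forall>a\<in>F. e \<otimes>\<^bsub>A\<^esub> a = a \<and> a \<otimes>\<^bsub>A\<^esub> e = a))"

definition normalisers :: "('r, 'a, 'n) module_scheme \<Rightarrow> 'a set \<Rightarrow> 'a set" where
  "normalisers A B =
     {n \<in> carrier A. \<exists>k \<in> carrier A.
        k \<otimes>\<^bsub>A\<^esub> n \<otimes>\<^bsub>A\<^esub> k = k \<and> n \<otimes>\<^bsub>A\<^esub> k \<otimes>\<^bsub>A\<^esub> n = n \<and>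
        (\<forall>b\<in>B. k \<otimes>\<^bsub>A\<^esub> b \<otimes>\<^bsub>A\<^esub> n \<in> B \<and> n \<otimes>\<^bsub>A\<^esub> b \<otimes>\<^bsub>A\<^esub> k \<in> B)}"

text \<open>
  Maps \<open>A \<rightarrow> B\<close> are functions on the underlying type that are constrained on \<open>carrier A\<close> only.
\<close>

definition conditional_expectation ::
    "('r, 'm) ring_scheme \<Rightarrow> ('r, 'a, 'n) module_scheme \<Rightarrow> 'a set \<Rightarrow> ('a \<Rightarrow> 'a) \<Rightarrow> bool" where
  "conditional_expectation R A B P \<longleftrightarrow>
     P \<in> carrier A \<rightarrow> B \<and>
     (\<forall>x \<in> carrier A. \<forall>y \<in> carrier A. P (x \<oplus>\<^bsub>A\<^esub> y) = P x \<oplus>\<^bsub>A\<^esub> P y) \<and>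
     (\<forall>t \<in> carrier R. \<forall>x \<in> carrier A. P (t \<odot>\<^bsub>A\<^esub> x) = t \<odot>\<^bsub>A\<^esub> P x) \<and>
     (\<forall>b\<in>B. P b = b) \<and>
     (\<forall>a \<in> carrier A. \<forall>b\<in>B. \<forall>b'\<in>B. P (b \<otimes>\<^bsub>A\<^esub> a \<otimes>\<^bsub>A\<^esub> b') = b \<otimes>\<^bsub>A\<^esub> P a \<otimes>\<^bsub>A\<^esub> b')"

definition faithful_expectation ::
    "('r, 'a, 'n) module_scheme \<Rightarrow> 'a set \<Rightarrow> ('a \<Rightarrow> 'a) \<Rightarrow> bool" where
  "faithful_expectation A B P \<longleftrightarrow>
     (\<forall>a \<in> carrier A - {\<zero>\<^bsub>A\<^esub>}. \<exists>n \<in> normalisers A B. P (n \<otimes>\<^bsub>A\<^esub> a) \<noteq> \<zero>\<^bsub>A\<^esub>)"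

definition implemented_by_idempotents ::
    "('r, 'a, 'n) module_scheme \<Rightarrow> 'a set \<Rightarrow> ('a \<Rightarrow> 'a) \<Rightarrow> bool" where
  "implemented_by_idempotents A B P \<longleftrightarrow>
     (\<forall>n \<in> normalisers A B. \<exists>e \<in> idempotents A B. P n = n \<otimes>\<^bsub>A\<^esub> e \<and> n \<otimes>\<^bsub>A\<^esub> e = e \<otimes>\<^bsub>A\<^esub> n)"

text \<open>The assumptions shared by algebraic Cartan and algebraic quasi-Cartan pairs.\<close>

locale algebraic_pair =
  assoc_algebra R A + comm_subalgebra B R A for R (structure) and A (structure) and B +
  assumes torsion_free:
      "\<lbrakk>t \<in> carrier R; e \<in> idempotents A B - {\<zero>\<^bsub>A\<^esub>}; t \<odot>\<^bsub>A\<^esub> e = \<zero>\<^bsub>A\<^esub>\<rbrakk> \<Longrightarrow> t = \<zero>\<^bsub>R\<^esub>"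
    and local_units: "local_units A (idempotents A B)"
    and span_idempotents: "B = lin_span R A (idempotents A B)"
    and span_normalisers: "carrier A = lin_span R A (normalisers A B)"
    and ex_faithful: "\<exists>P. conditional_expectation R A B P \<and> faithful_expectation A B P"

definition algebraic_cartan_pair ::
    "('r, 'm) ring_scheme \<Rightarrow> ('r, 'a, 'n) module_scheme \<Rightarrow> 'a set \<Rightarrow> bool" where
  "algebraic_cartan_pair R A B \<longleftrightarrow> algebraic_pair R A B \<and> maximal_comm_subalgebra B R A"

definition algebraic_quasi_cartan_pair ::
    "('r, 'm) ring_scheme \<Rightarrow> ('r, 'a, 'n) module_scheme \<Rightarrow> 'a set \<Rightarrow> bool" where
  "algebraic_quasi_cartan_pair R A B \<longleftrightarrow>
     algebraic_pair R A B \<and>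
     (\<exists>P. conditional_expectation R A B P \<and> faithful_expectation A B P \<and>
          implemented_by_idempotents A B P)"

end

theory Submission
  imports Defs
begin

text \<open>
  Let \<open>n\<close> be a normaliser with partial inverse \<open>k\<close>, and let \<open>P\<close> be a conditional expectation.
  Local units make \<open>nk\<close> and \<open>kn\<close> elements of \<open>B\<close>, and moving \<open>n\<close> past \<open>b \<in> B\<close> costs only a
  conjugation: \<open>nb = (nbk)n\<close> and \<open>bn = n(kbn)\<close>. Applying \<open>P\<close>, which is \<open>B\<close>-bilinear, gives the same
  two relations with \<open>P(n)\<close> in place of \<open>n\<close>. Together with \<open>knk = k\<close> and the commutativity of \<open>B\<close>,
  they imply that \<open>kP(n)\<close> and \<open>P(n)k\<close> commute with every element of \<open>B\<close>. A maximal commutative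
  subalgebra contains its commutant (\<open>maximal_comm_subalgebra_contains_commutant\<close>), so both
  products lie in \<open>B\<close> and \<open>P\<close> fixes them; by bilinearity again,
  \<open>kP(n) = P(k)P(n) = P(n)P(k) = P(n)k\<close>. This single element \<open>e\<close> is the implementing idempotent:
  \<open>ne = nkP(n) = P(nkn) = P(n)\<close> and likewise \<open>en = P(n)\<close>, while
  \<open>P(n)e = P(ne) = P(P(n)) = P(n)\<close> yields \<open>ee = kP(n)e = kP(n) = e\<close>.

  As the argument applies to every \<open>P\<close>, it applies to a faithful one, which makes the pair
  quasi-Cartan.
\<close>

definition commutant :: "('r, 'a, 'n) module_scheme \<Rightarrow> 'a set \<Rightarrow> 'a set" where
  "commutant A S = {x \<in> carrier A. \<forall>s\<in>S. x \<otimes>\<^bsub>A\<^esub> s = s \<otimes>\<^bsub>A\<^esub> x}"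

lemma commutant_antimono: "S \<subseteq> T \<Longrightarrow> commutant A T \<subseteq> commutant A S"
  by (auto simp: commutant_def)

lemma subset_double_commutant: "S \<subseteq> carrier A \<Longrightarrow> S \<subseteq> commutant A (commutant A S)"
  by (auto simp: commutant_def)

context assoc_algebra
begin

lemma mult_zero_l: "x \<in> carrier A \<Longrightarrow> \<zero>\<^bsub>A\<^esub> \<otimes>\<^bsub>A\<^esub> x = \<zero>\<^bsub>A\<^esub>"
  using smult_mult_l[of \<zero> "\<zero>\<^bsub>A\<^esub>" x] by (simp add: mult_closed)

lemma mult_zero_r: "x \<in> carrier A \<Longrightarrow> x \<otimes>\<^bsub>A\<^esub> \<zero>\<^bsub>A\<^esub> = \<zero>\<^bsub>A\<^esub>"
  using smult_mult_r[of \<zero> x "\<zero>\<^bsub>A\<^esub>"] by (simp add: mult_closed)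

lemma submodule_commutant:
  assumes "S \<subseteq> carrier A"
  shows "submodule (commutant A S) R A"
proof (rule submoduleI)
  show "\<zero>\<^bsub>A\<^esub> \<in> commutant A S"
    using assms by (auto simp: commutant_def mult_zero_l mult_zero_r)
next
  fix x assume x: "x \<in> commutant A S"
  have minus: "\<ominus>\<^bsub>A\<^esub> x = (\<ominus> \<one>) \<odot>\<^bsub>A\<^esub> x"
    using x by (simp add: commutant_def smult_l_minus)
  show "\<ominus>\<^bsub>A\<^esub> x \<in> commutant A S"
    unfolding minus using x assms by (auto simp: commutant_def smult_mult_l smult_mult_r subset_iff)
next
  fix x y assume "x \<in> commutant A S" "y \<in> commutant A S"
  then show "x \<oplus>\<^bsub>A\<^esub> y \<in> commutant A S"
    using assms by (auto simp: commutant_def mult_l_distr mult_r_distr subset_iff)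
next
  fix t x assume "t \<in> carrier R" "x \<in> commutant A S"
  then show "t \<odot>\<^bsub>A\<^esub> x \<in> commutant A S"
    using assms by (auto simp: commutant_def smult_mult_l smult_mult_r subset_iff)
qed (auto simp: commutant_def)

lemma commutant_mult_closed:
  assumes "S \<subseteq> carrier A" "x \<in> commutant A S" "y \<in> commutant A S"
  shows "x \<otimes>\<^bsub>A\<^esub> y \<in> commutant A S"
proof -
  have "(x \<otimes>\<^bsub>A\<^esub> y) \<otimes>\<^bsub>A\<^esub> s = s \<otimes>\<^bsub>A\<^esub> (x \<otimes>\<^bsub>A\<^esub> y)" if "s \<in> S" for s
  proof -
    have *: "s \<in> carrier A" "x \<in> carrier A" "y \<in> carrier A"
      "x \<otimes>\<^bsub>A\<^esub> s = s \<otimes>\<^bsub>A\<^esub> x" "y \<otimes>\<^bsub>A\<^esub> s = s \<otimes>\<^bsub>A\<^esub> y"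
      using assms that by (auto simp: commutant_def)
    have "(x \<otimes>\<^bsub>A\<^esub> y) \<otimes>\<^bsub>A\<^esub> s = x \<otimes>\<^bsub>A\<^esub> (s \<otimes>\<^bsub>A\<^esub> y)"
      using * by (simp add: mult_assoc)
    also have "\<dots> = (s \<otimes>\<^bsub>A\<^esub> x) \<otimes>\<^bsub>A\<^esub> y"
      using * by (simp flip: mult_assoc)
    finally show ?thesis using * by (simp add: mult_assoc)
  qed
  then show ?thesis using assms by (auto simp: commutant_def mult_closed)
qed

text \<open>
  The double commutant serves as the subalgebra generated by \<open>S\<close> without any need to describe
  polynomials in its elements: pairwise commutation means \<open>S \<subseteq> S'\<close>, hence \<open>S'' \<subseteq> S'\<close>, and every
  element of \<open>S''\<close> commutes with all of \<open>S'\<close>.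
\<close>

lemma comm_subalgebra_double_commutant:
  assumes S: "S \<subseteq> carrier A" and comm: "\<And>x y. x \<in> S \<Longrightarrow> y \<in> S \<Longrightarrow> x \<otimes>\<^bsub>A\<^esub> y = y \<otimes>\<^bsub>A\<^esub> x"
  shows "comm_subalgebra (commutant A (commutant A S)) R A"
proof -
  have S': "commutant A S \<subseteq> carrier A" by (auto simp: commutant_def)
  have "S \<subseteq> commutant A S" using S comm by (auto simp: commutant_def)
  then have sub: "commutant A (commutant A S) \<subseteq> commutant A S" by (rule commutant_antimono)
  show ?thesis
  proof (intro comm_subalgebra.intro comm_subalgebra_axioms.intro)
    show "submodule (commutant A (commutant A S)) R A" using S' by (rule submodule_commutant)
  next
    fix x y assume "x \<in> commutant A (commutant A S)" "y \<in> commutant A (commutant A S)"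
    then show "x \<otimes>\<^bsub>A\<^esub> y \<in> commutant A (commutant A S)" by (rule commutant_mult_closed[OF S'])
  next
    fix x y assume xy: "x \<in> commutant A (commutant A S)" "y \<in> commutant A (commutant A S)"
    then have "y \<in> commutant A S" using sub by blast
    then show "x \<otimes>\<^bsub>A\<^esub> y = y \<otimes>\<^bsub>A\<^esub> x" using xy(1) by (simp add: commutant_def)
  qed
qed

text \<open>
  An element \<open>c\<close> commuting with \<open>B\<close> lies in a commutative subalgebra that also contains \<open>B\<close>, namely the
  double commutant of \<open>B \<union> {c}\<close>; by maximality this subalgebra is \<open>B\<close>.
\<close>

lemma maximal_comm_subalgebra_contains_commutant:
  assumes max: "maximal_comm_subalgebra B R A"
  shows "commutant A B \<subseteq> B"
proof
  fix c assume c: "c \<in> commutant A B"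
  interpret comm_subalgebra B R A using max by (simp add: maximal_comm_subalgebra_def)
  let ?C = "commutant A (commutant A (insert c B))"
  have sub: "insert c B \<subseteq> carrier A" using c subset by (auto simp: commutant_def)
  have "comm_subalgebra ?C R A"
    using c by (intro comm_subalgebra_double_commutant sub) (auto simp: commutant_def sub_mult_comm)
  moreover have "insert c B \<subseteq> ?C" using sub by (rule subset_double_commutant)
  ultimately show "c \<in> B" using max by (auto simp: maximal_comm_subalgebra_def)
qed

end

context algebraic_pair
begin

lemma in_carrier: "b \<in> B \<Longrightarrow> b \<in> carrier A"
  using subset by auto

lemma ex_local_unit:
  assumes "finite F" "F \<subseteq> carrier A"
  shows "\<exists>u\<in>B. \<forall>a\<in>F. u \<otimes>\<^bsub>A\<^esub> a = a \<and> a \<otimes>\<^bsub>A\<^esub> u = a"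
proof -
  obtain u where "u \<in> idempotents A B" "\<forall>a\<in>F. u \<otimes>\<^bsub>A\<^esub> a = a \<and> a \<otimes>\<^bsub>A\<^esub> u = a"
    using local_units assms unfolding local_units_def by meson
  then show ?thesis by (intro bexI[of _ u]) (simp_all add: idempotents_def)
qed

lemma expectation_in_B:
  "conditional_expectation R A B P \<Longrightarrow> a \<in> carrier A \<Longrightarrow> P a \<in> B"
  unfolding conditional_expectation_def by (elim conjE) (rule funcset_mem[of P])

text \<open>
  \<open>B\<close> may lack a unit, so one-sided linearity follows from the two-sided law by inserting a
  local unit for both \<open>a\<close> and \<open>P a\<close> on the other side.
\<close>

lemma expectation_mult_l:
  assumes P: "conditional_expectation R A B P" and a: "a \<in> carrier A" and b: "b \<in> B"
  shows "P (b \<otimes>\<^bsub>A\<^esub> a) = b \<otimes>\<^bsub>A\<^esub> P a"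
proof -
  have Pa: "P a \<in> carrier A" using expectation_in_B[OF P a] by (rule in_carrier)
  obtain u where u: "u \<in> B" "a \<otimes>\<^bsub>A\<^esub> u = a" "P a \<otimes>\<^bsub>A\<^esub> u = P a"
    using ex_local_unit[of "{a, P a}"] a Pa by auto
  have "P (b \<otimes>\<^bsub>A\<^esub> a \<otimes>\<^bsub>A\<^esub> u) = b \<otimes>\<^bsub>A\<^esub> P a \<otimes>\<^bsub>A\<^esub> u"
    using P a b u(1) by (simp add: conditional_expectation_def)
  then show ?thesis using u a b Pa by (simp add: mult_assoc in_carrier)
qed

lemma expectation_mult_r:
  assumes P: "conditional_expectation R A B P" and a: "a \<in> carrier A" and b: "b \<in> B"
  shows "P (a \<otimes>\<^bsub>A\<^esub> b) = P a \<otimes>\<^bsub>A\<^esub> b"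
proof -
  have Pa: "P a \<in> carrier A" using expectation_in_B[OF P a] by (rule in_carrier)
  obtain u where u: "u \<in> B" "u \<otimes>\<^bsub>A\<^esub> a = a" "u \<otimes>\<^bsub>A\<^esub> P a = P a"
    using ex_local_unit[of "{a, P a}"] a Pa by auto
  have "P (u \<otimes>\<^bsub>A\<^esub> a \<otimes>\<^bsub>A\<^esub> b) = u \<otimes>\<^bsub>A\<^esub> P a \<otimes>\<^bsub>A\<^esub> b"
    using P a b u(1) by (simp add: conditional_expectation_def)
  then show ?thesis using u by simp
qed

text \<open>
  A local unit for \<open>n\<close> is the witness: it lies in \<open>B\<close> and disappears from \<open>nuk\<close>. For a normaliser
  this gives \<open>nk \<in> B\<close> and, with the roles exchanged, \<open>kn \<in> B\<close>.
\<close>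

lemma mult_in_B_if_conjugation_in_B:
  assumes "n \<in> carrier A" "k \<in> carrier A" "\<And>b. b \<in> B \<Longrightarrow> n \<otimes>\<^bsub>A\<^esub> b \<otimes>\<^bsub>A\<^esub> k \<in> B"
  shows "n \<otimes>\<^bsub>A\<^esub> k \<in> B"
proof -
  obtain u where "u \<in> B" "n \<otimes>\<^bsub>A\<^esub> u = n"
    using ex_local_unit[of "{n}"] assms(1) by auto
  then show ?thesis using assms(3)[of u] by simp
qed

theorem implemented_by_idempotents_if_maximal:
  assumes max: "maximal_comm_subalgebra B R A" and P: "conditional_expectation R A B P"
  shows "implemented_by_idempotents A B P"
  unfolding implemented_by_idempotents_def
proof
  fix n assume "n \<in> normalisers A B"
  then obtain k where n: "n \<in> carrier A" and k: "k \<in> carrier A"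
    and knk: "k \<otimes>\<^bsub>A\<^esub> n \<otimes>\<^bsub>A\<^esub> k = k" and nkn: "n \<otimes>\<^bsub>A\<^esub> k \<otimes>\<^bsub>A\<^esub> n = n"
    and kBn: "\<And>b. b \<in> B \<Longrightarrow> k \<otimes>\<^bsub>A\<^esub> b \<otimes>\<^bsub>A\<^esub> n \<in> B"
    and nBk: "\<And>b. b \<in> B \<Longrightarrow> n \<otimes>\<^bsub>A\<^esub> b \<otimes>\<^bsub>A\<^esub> k \<in> B"
    unfolding normalisers_def by blast
  have P_fix: "P b = b" if "b \<in> B" for b
    using P that by (simp add: conditional_expectation_def)
  note P_B = expectation_in_B[OF P]
    and lin_l = expectation_mult_l[OF P]
    and lin_r = expectation_mult_r[OF P]
  note [simp] = n k mult_closed in_carrier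
  have kn: "k \<otimes>\<^bsub>A\<^esub> n \<in> B" using kBn by (rule mult_in_B_if_conjugation_in_B[OF k n])
  have nk: "n \<otimes>\<^bsub>A\<^esub> k \<in> B" using nBk by (rule mult_in_B_if_conjugation_in_B[OF n k])
  have Pn: "P n \<in> B" by (simp add: P_B)
  \<comment> \<open>In both relations, \<open>P\<close> is applied to the corresponding relation for \<open>n\<close>, which holds because
    the idempotents \<open>kn\<close> and \<open>nk\<close> commute with \<open>b\<close>.\<close>
  have P_shift_r: "P n \<otimes>\<^bsub>A\<^esub> b = (n \<otimes>\<^bsub>A\<^esub> b \<otimes>\<^bsub>A\<^esub> k) \<otimes>\<^bsub>A\<^esub> P n" if b: "b \<in> B" for b
  proof -
    have "n \<otimes>\<^bsub>A\<^esub> b = n \<otimes>\<^bsub>A\<^esub> ((k \<otimes>\<^bsub>A\<^esub> n) \<otimes>\<^bsub>A\<^esub> b)"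
      using b nkn by (simp flip: mult_assoc)
    also have "\<dots> = n \<otimes>\<^bsub>A\<^esub> (b \<otimes>\<^bsub>A\<^esub> (k \<otimes>\<^bsub>A\<^esub> n))"
      using sub_mult_comm[OF kn b] by simp
    also have "\<dots> = (n \<otimes>\<^bsub>A\<^esub> b \<otimes>\<^bsub>A\<^esub> k) \<otimes>\<^bsub>A\<^esub> n"
      using b by (simp add: mult_assoc)
    finally have "P (n \<otimes>\<^bsub>A\<^esub> b) = P ((n \<otimes>\<^bsub>A\<^esub> b \<otimes>\<^bsub>A\<^esub> k) \<otimes>\<^bsub>A\<^esub> n)" by simp
    then show ?thesis using lin_r[OF n b] lin_l[OF n nBk[OF b]] by simp
  qed
  have P_shift_l: "b \<otimes>\<^bsub>A\<^esub> P n = P n \<otimes>\<^bsub>A\<^esub> (k \<otimes>\<^bsub>A\<^esub> b \<otimes>\<^bsub>A\<^esub> n)" if b: "b \<in> B" for b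
  proof -
    have "b \<otimes>\<^bsub>A\<^esub> n = (b \<otimes>\<^bsub>A\<^esub> (n \<otimes>\<^bsub>A\<^esub> k)) \<otimes>\<^bsub>A\<^esub> n"
      using b nkn by (simp add: mult_assoc)
    also have "\<dots> = ((n \<otimes>\<^bsub>A\<^esub> k) \<otimes>\<^bsub>A\<^esub> b) \<otimes>\<^bsub>A\<^esub> n"
      using sub_mult_comm[OF nk b] by simp
    also have "\<dots> = n \<otimes>\<^bsub>A\<^esub> (k \<otimes>\<^bsub>A\<^esub> b \<otimes>\<^bsub>A\<^esub> n)"
      using b by (simp add: mult_assoc)
    finally have "P (b \<otimes>\<^bsub>A\<^esub> n) = P (n \<otimes>\<^bsub>A\<^esub> (k \<otimes>\<^bsub>A\<^esub> b \<otimes>\<^bsub>A\<^esub> n))" by simp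
    then show ?thesis using lin_l[OF n b] lin_r[OF n kBn[OF b]] by simp
  qed
  define e where "e = k \<otimes>\<^bsub>A\<^esub> P n"
  have e: "e \<in> B"
  proof -
    have "e \<otimes>\<^bsub>A\<^esub> b = b \<otimes>\<^bsub>A\<^esub> e" if b: "b \<in> B" for b
    proof -
      have "e \<otimes>\<^bsub>A\<^esub> b = k \<otimes>\<^bsub>A\<^esub> ((n \<otimes>\<^bsub>A\<^esub> b \<otimes>\<^bsub>A\<^esub> k) \<otimes>\<^bsub>A\<^esub> P n)"
        using b Pn P_shift_r[OF b] by (simp add: e_def mult_assoc)
      also have "\<dots> = ((k \<otimes>\<^bsub>A\<^esub> n) \<otimes>\<^bsub>A\<^esub> b) \<otimes>\<^bsub>A\<^esub> (k \<otimes>\<^bsub>A\<^esub> P n)"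
        using b Pn by (simp add: mult_assoc)
      also have "\<dots> = (b \<otimes>\<^bsub>A\<^esub> (k \<otimes>\<^bsub>A\<^esub> n)) \<otimes>\<^bsub>A\<^esub> (k \<otimes>\<^bsub>A\<^esub> P n)"
        using sub_mult_comm[OF kn b] by simp
      also have "\<dots> = b \<otimes>\<^bsub>A\<^esub> ((k \<otimes>\<^bsub>A\<^esub> n \<otimes>\<^bsub>A\<^esub> k) \<otimes>\<^bsub>A\<^esub> P n)"
        using b Pn by (simp add: mult_assoc)
      finally show ?thesis by (simp add: knk e_def)
    qed
    then have "e \<in> commutant A B" using Pn by (simp add: commutant_def e_def)
    then show ?thesis using maximal_comm_subalgebra_contains_commutant[OF max] by blast
  qed
  have Pn_k: "P n \<otimes>\<^bsub>A\<^esub> k \<in> B"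
  proof -
    have "(P n \<otimes>\<^bsub>A\<^esub> k) \<otimes>\<^bsub>A\<^esub> b = b \<otimes>\<^bsub>A\<^esub> (P n \<otimes>\<^bsub>A\<^esub> k)" if b: "b \<in> B" for b
    proof -
      have "b \<otimes>\<^bsub>A\<^esub> (P n \<otimes>\<^bsub>A\<^esub> k) = (P n \<otimes>\<^bsub>A\<^esub> (k \<otimes>\<^bsub>A\<^esub> b \<otimes>\<^bsub>A\<^esub> n)) \<otimes>\<^bsub>A\<^esub> k"
        using b Pn P_shift_l[OF b] by (simp flip: mult_assoc)
      also have "\<dots> = (P n \<otimes>\<^bsub>A\<^esub> k) \<otimes>\<^bsub>A\<^esub> (b \<otimes>\<^bsub>A\<^esub> (n \<otimes>\<^bsub>A\<^esub> k))"
        using b Pn by (simp add: mult_assoc)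
      also have "\<dots> = (P n \<otimes>\<^bsub>A\<^esub> k) \<otimes>\<^bsub>A\<^esub> ((n \<otimes>\<^bsub>A\<^esub> k) \<otimes>\<^bsub>A\<^esub> b)"
        using sub_mult_comm[OF nk b] by simp
      also have "\<dots> = (P n \<otimes>\<^bsub>A\<^esub> (k \<otimes>\<^bsub>A\<^esub> n \<otimes>\<^bsub>A\<^esub> k)) \<otimes>\<^bsub>A\<^esub> b"
        using b Pn by (simp add: mult_assoc)
      finally show ?thesis by (simp add: knk)
    qed
    then have "P n \<otimes>\<^bsub>A\<^esub> k \<in> commutant A B" using Pn by (simp add: commutant_def)
    then show ?thesis using maximal_comm_subalgebra_contains_commutant[OF max] by blast
  qed
  have e_eq: "e = P n \<otimes>\<^bsub>A\<^esub> k"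
  proof -
    have "e = P k \<otimes>\<^bsub>A\<^esub> P n" using P_fix[OF e] lin_r[OF k Pn] by (simp add: e_def)
    also have "\<dots> = P n \<otimes>\<^bsub>A\<^esub> P k" using Pn by (simp add: sub_mult_comm P_B)
    also have "\<dots> = P n \<otimes>\<^bsub>A\<^esub> k" using P_fix[OF Pn_k] lin_l[OF k Pn] by simp
    finally show ?thesis .
  qed
  have ne: "n \<otimes>\<^bsub>A\<^esub> e = P n"
    using lin_l[OF n nk] nkn Pn by (simp add: e_def mult_assoc)
  have en: "e \<otimes>\<^bsub>A\<^esub> n = P n"
    using lin_r[OF n kn] nkn Pn by (simp add: e_eq mult_assoc)
  have "P n \<otimes>\<^bsub>A\<^esub> e = P n"
    using lin_r[OF n e] P_fix[OF Pn] by (simp add: ne)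
  then have "e \<otimes>\<^bsub>A\<^esub> e = e"
    using e Pn by (simp add: e_def mult_assoc)
  then show "\<exists>e\<in>idempotents A B. P n = n \<otimes>\<^bsub>A\<^esub> e \<and> n \<otimes>\<^bsub>A\<^esub> e = e \<otimes>\<^bsub>A\<^esub> n"
    using e ne en by (auto simp: idempotents_def)
qed

end

theorem lemma3p6:
  fixes R :: "('r, 'm) ring_scheme"
    and A :: "('r, 'a, 'n) module_scheme"
    and B :: "'a set"
  assumes "cring R"
    and "algebraic_cartan_pair R A B"
  shows "algebraic_quasi_cartan_pair R A B \<and>
    (\<forall>P. conditional_expectation R A B P \<longrightarrow> implemented_by_idempotents A B P)"
proof -
  have pair: "algebraic_pair R A B" and max: "maximal_comm_subalgebra B R A"
    using assms(2) by (simp_all add: algebraic_cartan_pair_def)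
  interpret algebraic_pair R A B by (rule pair)
  show ?thesis
    using pair ex_faithful implemented_by_idempotents_if_maximal[OF max]
    by (auto simp: algebraic_quasi_cartan_pair_def)
qed

end
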